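(* Let $p\geq 3$ be a prime. Then there are infinitely many positive integers $n$ that cannot be written as the sum of the norm of an ideal in $\mathbb{Z}[\exp(2\pi i/p)]$ and at most $p-2$ powers of $p$; that is, there are infinitely many positive integers $n$ for which there do not exist $m\in\mathcal{M}_p$, an integer $j$ with $0\leq j\leq p-2$, and integers $b_1,\dots,b_j\geq 0$ such that $n=m+p^{b_1}+\cdots+p^{b_j}$.
   Context: For a prime $p\ge 3$, $\mathcal{M}_p$ denotes the set of positive integers that are norms of ideals of $\mathbb{Z}[\exp(2\pi i/p)]$, where the norm of a nonzero ideal $I$ is the index $|\mathbb{Z}[\exp(2\pi i/p)]/I|$. A power of $p$ means $p^b$ with $b\geq 0$ an integer (so $1$ is a power of $p$). Powers may be repeated in a sum, and "at most $p-2$" includes using no powers. *)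

theory Defs
  imports
    Complex_Main
    "HOL-Computational_Algebra.Primes"
    "HOL-Algebra.Generated_Rings"
    "HOL-Algebra.QuotRing"
    "HOL-Algebra.Algebraic_Closure_Type"
begin

definition cyclotomic_ring :: "nat \<Rightarrow> complex ring" where
  "cyclotomic_ring p =
     (ring_of_type_algebra :: complex ring)
       \<lparr>carrier := generate_ring ring_of_type_algebra {exp (2 * of_real pi * \<i> / of_nat p)}\<rparr>"

text \<open>\<open>card\<close> is 0 for an ideal of infinite index.\<close>

definition ideal_norm :: "('a, 'b) ring_scheme \<Rightarrow> 'a set \<Rightarrow> nat" where
  "ideal_norm R I = card (carrier (R Quot I))"

definition norm_set :: "nat \<Rightarrow> nat set" where
  "norm_set p = {n. n > 0 \<and>
     (\<exists>I. ideal I (cyclotomic_ring p) \<and> I \<noteq> {\<zero>\<^bsub>cyclotomic_ring p\<^esub>} \<and>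
          n = ideal_norm (cyclotomic_ring p) I)}"

end

(*
  The proof looks at a finite quotient Q of Z[zeta] and at the multiplication by zeta on Q.
  Its p-th power is the identity, and a fixed point x satisfies p x = 0, because 1 - zeta
  divides p. If p does not divide |Q|, then 0 is the only fixed point, so |Q| = 1 (mod p).
  If |Q| is even, an element t of order 2 and zeta t generate an additive subgroup of order 4,
  so 4 divides |Q|. Now take n = m + (p - 2) with m = 1 (mod p) and m = 2 (mod 4). As n = -1
  (mod p) and every norm is 0 or 1 (mod p), a representation of n uses exactly p - 2 powers, all
  equal to 1, and the norm m; but m is not a norm.
*)
theory Submission
  imports Defs "HOL-Number_Theory.Cong"
begin

section \<open>Fixed points of a map whose \<open>p\<close>-th iterate is the identity\<close>

lemma funpow_prime_fixed:
  assumes "prime p" "(f ^^ p) x = x" "(f ^^ i) x = x" "0 < i" "i < p"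
  shows "f x = x"
proof -
  have "coprime i p"
    using assms(1,4,5) by (metis coprime_commute nat_dvd_not_less prime_imp_coprime)
  \<comment> \<open>For \<open>a\<close> inverse to \<open>i\<close> modulo \<open>p\<close>, the
    iterate \<open>f ^^ (i * a)\<close> sends \<open>x\<close> to itself because \<open>i\<close>
    divides the exponent, and to \<open>f x\<close> because the exponent is 1 modulo
    \<open>p\<close>.\<close>
  then obtain a where a: "[i * a = Suc 0] (mod p)"
    using cong_solve_coprime_nat by blast
  have "1 < p" using assms(1) prime_gt_1_nat by blast
  have "(f ^^ (i * a)) x = (f ^^ ((i * a) mod i)) x"
    using funpow_mod_eq[OF assms(3)] by metis
  moreover have "(f ^^ (i * a)) x = (f ^^ ((i * a) mod p)) x"
    using funpow_mod_eq[OF assms(2)] by metis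
  moreover have "(i * a) mod p = 1"
    using a \<open>1 < p\<close> by (simp add: cong_def)
  ultimately show ?thesis by simp
qed

text \<open>Without fixed points every orbit has exactly \<open>p\<close> elements. The induction on
  \<open>card S\<close> removes one orbit \<open>B\<close> at a time.\<close>

lemma prime_dvd_card_if_no_fixpoint:
  fixes f :: "'a \<Rightarrow> 'a"
  assumes "prime p" "finite S" "\<And>x. x \<in> S \<Longrightarrow> f x \<in> S" "\<And>x. x \<in> S \<Longrightarrow> (f ^^ p) x = x"
    and "\<And>x. x \<in> S \<Longrightarrow> f x \<noteq> x"
  shows "p dvd card S"
  using assms(2-5)
proof (induction "card S" arbitrary: S rule: less_induct)
  case less
  show ?case
  proof (cases "S = {}")
    case False
    then obtain x where x: "x \<in> S" by blast
    have "0 < p" using assms(1) prime_gt_0_nat by blast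
    define B where "B = (\<lambda>i. (f ^^ i) x) ` {..<p}"
    have in_S: "(f ^^ i) y \<in> S" if "y \<in> S" for i y
      using that less.prems(2) by (induction i) auto
    have BS: "B \<subseteq> S"
      using in_S x by (auto simp: B_def)
    \<comment> \<open>A coincidence of the iterates \<open>i < j\<close> would make
      \<open>(f ^^ i) x\<close> a fixed point of \<open>f ^^ (j - i)\<close> with
      \<open>0 < j - i < p\<close>, hence a fixed point of \<open>f\<close>.\<close>
    have "inj_on (\<lambda>i. (f ^^ i) x) {..<p}"
    proof (rule linorder_inj_onI)
      fix i j assume ij: "i < j" "i \<in> {..<p}" "j \<in> {..<p}"
      show "(f ^^ i) x \<noteq> (f ^^ j) x"
      proof
        assume "(f ^^ i) x = (f ^^ j) x"
        also have "(f ^^ j) x = (f ^^ (j - i)) ((f ^^ i) x)"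
          using ij by (simp flip: funpow_add[THEN fun_cong, simplified])
        finally show False
          using funpow_prime_fixed[OF assms(1), of f "(f ^^ i) x" "j - i"] ij
            less_imp_diff_less[of j p i] in_S[OF x] less.prems(3,4) by simp
      qed
    qed auto
    then have cB: "card B = p"
      by (simp add: B_def card_image)
    have B_closed: "(f ^^ i) x \<in> B" for i
    proof -
      have "(f ^^ i) x = (f ^^ (i mod p)) x"
        using funpow_mod_eq[OF less.prems(3)[OF x]] by metis
      then show ?thesis using \<open>0 < p\<close> by (auto simp: B_def)
    qed
    \<comment> \<open>On \<open>S\<close> the map \<open>f\<close> is undone by
      \<open>f ^^ (p - 1)\<close>, so a point sent into the orbit \<open>B\<close> already lies in
      \<open>B\<close>.\<close>
    have diff_closed: "f y \<in> S - B" if "y \<in> S - B" for y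
    proof -
      have False if fy: "f y \<in> B"
      proof -
        obtain i where i: "f y = (f ^^ i) x" using fy by (auto simp: B_def)
        have "y = (f ^^ (p - 1)) (f y)"
          using less.prems(3)[of y] \<open>y \<in> S - B\<close> \<open>0 < p\<close>
          by (cases p) (auto simp: funpow_swap1)
        also have "\<dots> = (f ^^ (p - 1 + i)) x"
          by (simp add: i funpow_add)
        finally show False using B_closed \<open>y \<in> S - B\<close> by (metis DiffD2)
      qed
      then show ?thesis using that less.prems(2) by blast
    qed
    have card: "card S = card (S - B) + p"
      using BS cB less.prems(1) card_mono[OF less.prems(1) BS]
      by (simp add: card_Diff_subset finite_subset)
    have "p dvd card (S - B)"
      using less.hyps[of "S - B"] card \<open>0 < p\<close> less.prems diff_closed by auto
    then show ?thesis by (simp add: card)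
  qed simp
qed

lemma card_cong_card_fixpoints:
  fixes f :: "'a \<Rightarrow> 'a"
  assumes "prime p" "finite S" "\<And>x. x \<in> S \<Longrightarrow> f x \<in> S" "\<And>x. x \<in> S \<Longrightarrow> (f ^^ p) x = x"
  shows "[card S = card {x \<in> S. f x = x}] (mod p)"
proof -
  let ?F = "{x \<in> S. f x = x}"
  have "f x \<in> S - ?F" if "x \<in> S - ?F" for x
  proof -
    \<comment> \<open>If \<open>f x\<close> is fixed, all its iterates are \<open>f x\<close>; the
      iterate \<open>p - 1\<close> of it is \<open>x\<close>, so \<open>x\<close> would be fixed
      too. Thus the points that are not fixed form a stable set without fixed points.\<close>
    have False if "f (f x) = f x"
    proof -
      have "(f ^^ i) (f x) = f x" for i
        by (induction i) (auto simp: that)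
      from this[of "p - 1"] have "(f ^^ p) x = f x"
        using prime_gt_0_nat[OF assms(1)] by (cases p) (auto simp: funpow_swap1)
      then show False using assms(4) \<open>x \<in> S - ?F\<close> by auto
    qed
    then show ?thesis using that assms(3) by blast
  qed
  then have "p dvd card (S - ?F)"
    using assms by (intro prime_dvd_card_if_no_fixpoint[of p "S - ?F" f]) auto
  moreover have "card S = card (S - ?F) + card ?F"
    using card_mono[OF assms(2), of ?F] assms(2) by (simp add: card_Diff_subset)
  ultimately have "[card S = 0 + card ?F] (mod p)"
    by (simp only:) (intro cong_add cong_refl, simp only: cong_0_iff)
  then show ?thesis by simp
qed

section \<open>Finite commutative rings with an element \<open>z\<close> whose \<open>p\<close>-th
  power is 1\<close>

context cring
begin

text \<open>The hypothesis on \<open>w\<close> says p = (1 - z) w, written without subtraction. A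
  fixed point of multiplication by \<open>z\<close> is killed by 1 - z, hence by its multiple
  p.\<close>

lemma fixed_by_mult_imp_p_torsion:
  assumes "z \<in> carrier R" "w \<in> carrier R" "[p] \<cdot> \<one> \<oplus> z \<otimes> w = w"
    and "x \<in> carrier R" "z \<otimes> x = x"
  shows "[(p::nat)] \<cdot> x = \<zero>"
proof -
  have closed: "[p] \<cdot> x \<in> carrier R" "w \<otimes> x \<in> carrier R"
    using assms by auto
  have "w \<otimes> x = ([p] \<cdot> \<one> \<oplus> z \<otimes> w) \<otimes> x"
    using assms(3) by simp
  also have "\<dots> = [p] \<cdot> x \<oplus> w \<otimes> (z \<otimes> x)"
    using add_pow_ldistr[of \<one> x p] assms(1,2,4) by (simp add: l_distr m_assoc m_lcomm[of z w x])
  finally show ?thesis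
    using closed assms(5) add.r_cancel_one'[of "w \<otimes> x" "[p] \<cdot> x"] by simp
qed

lemma coprime_torsion_eq_zero:
  assumes "x \<in> carrier R" "[(m::nat)] \<cdot> x = \<zero>" "[(n::nat)] \<cdot> x = \<zero>" "coprime m n"
  shows "x = \<zero>"
\<comment> \<open>\<open>bezout_nat\<close> wants a nonzero \<open>m\<close>. If
  \<open>m = 0\<close>, coprimality forces \<open>n = 1\<close>, and the second torsion equation
  already says \<open>x = \<zero>\<close>.\<close>
proof (cases "m = 0")
  case True
  then show ?thesis using assms by simp
next
  case False
  then obtain a b where ab: "m * a = n * b + 1"
    using bezout_nat[of m n] assms(4) by auto
  have "[(m * a)] \<cdot> x = [a] \<cdot> ([m] \<cdot> x)" "[(n * b)] \<cdot> x = [b] \<cdot> ([n] \<cdot> x)"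
    using assms(1) by (simp_all add: add.nat_pow_pow mult.commute)
  then have "[(m * a)] \<cdot> x = \<zero>" "[(n * b)] \<cdot> x = \<zero>"
    using assms(2,3) by simp_all
  then show ?thesis
    using assms(1) ab by (simp add: add.nat_pow_mult[symmetric])
qed

lemma order_torsion:
  assumes "x \<in> carrier R"
  shows "[card (carrier R)] \<cdot> x = \<zero>"
  using add.pow_order_eq_1[of x] assms by (simp add: Coset.order_def)

lemma funpow_mult_eq_pow_mult:
  assumes "z \<in> carrier R" "x \<in> carrier R"
  shows "((\<lambda>x. z \<otimes> x) ^^ n) x = z [^] n \<otimes> x"
  using assms by (induction n) (auto simp: m_ac)

lemma card_cong_one_mod_prime:
  assumes "prime p" "finite (carrier R)" "\<not> p dvd card (carrier R)"
    and z: "z \<in> carrier R" "z [^] p = \<one>"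
    and w: "w \<in> carrier R" "[p] \<cdot> \<one> \<oplus> z \<otimes> w = w"
  shows "[card (carrier R) = 1] (mod p)"
proof -
  have cop: "coprime p (card (carrier R))"
    using assms(1,3) by (simp add: prime_imp_coprime)
  \<comment> \<open>A fixed point is killed by \<open>p\<close> and, by Lagrange, by the order of
    the additive group; these two numbers are coprime.\<close>
  have "x = \<zero>" if "x \<in> carrier R" "z \<otimes> x = x" for x
    using coprime_torsion_eq_zero[OF that(1) _ order_torsion[OF that(1)] cop]
      fixed_by_mult_imp_p_torsion[OF z(1) w that] by blast
  then have "{x \<in> carrier R. z \<otimes> x = x} = {\<zero>}"
    using z(1) by auto
  then show ?thesis
    using card_cong_card_fixpoints[of p "carrier R" "\<lambda>x. z \<otimes> x"] assms(1,2) z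
    by (simp add: funpow_mult_eq_pow_mult)
qed

lemma four_dvd_card_if_even:
  fixes p :: nat
  assumes "odd p" "finite (carrier R)" "even (card (carrier R))"
    and z: "z \<in> carrier R" "z [^] p = \<one>"
    and w: "w \<in> carrier R" "[p] \<cdot> \<one> \<oplus> z \<otimes> w = w"
  shows "4 dvd card (carrier R)"
proof -
  define T where "T = {x \<in> carrier R. \<ominus> x = x}"
  \<comment> \<open>Negation is an involution, so the number of its fixed points has the parity of
    the order. This number is even and \<open>\<zero>\<close> is one of them, so there is another
    one, an element of order 2.\<close>
  have "((\<lambda>x. \<ominus> x) ^^ 2) x = x" if "x \<in> carrier R" for x
    using that by (simp add: numeral_2_eq_2)
  then have "[card (carrier R) = card T] (mod 2)"
    unfolding T_def using two_is_prime_nat assms(2)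
    by (intro card_cong_card_fixpoints) simp_all
  then have "even (card T)"
    using assms(3) by (simp add: cong_dvd_iff)
  moreover have "\<zero> \<in> T" by (simp add: T_def)
  ultimately obtain t where "t \<in> T" "t \<noteq> \<zero>"
    by (metis is_singletonI' is_singleton_altdef odd_one empty_iff)
  then have t: "t \<in> carrier R" "\<ominus> t = t" "t \<noteq> \<zero>" by (simp_all add: T_def)
  define u where "u = z \<otimes> t"
  have tt: "t \<oplus> t = \<zero>" using r_neg[OF t(1)] t(2) by simp
  have u: "u \<in> carrier R" using z t by (simp add: u_def)
  have uu: "u \<oplus> u = \<zero>" using z t tt by (simp add: u_def r_distr[symmetric])
  have "\<ominus> u = u" using u uu by (simp add: minus_equality)
  \<comment> \<open>Multiplication by \<open>z\<close> is injective: applying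
    \<open>z [^] (p - 1)\<close> to \<open>u\<close> gives back \<open>t\<close>.\<close>
  have "u \<noteq> \<zero>"
  proof
    assume "u = \<zero>"
    have "z [^] p \<otimes> t = z [^] (p - 1) \<otimes> u"
      using odd_pos[OF assms(1)] z t by (cases p) (auto simp: u_def m_ac)
    then show False using \<open>u = \<zero>\<close> z t by simp
  qed
  \<comment> \<open>If \<open>u = t\<close>, then \<open>t\<close> is fixed by \<open>z\<close>, so
    it is killed by \<open>p\<close> as well as by 2. This is where the oddness of \<open>p\<close>
    enters.\<close>
  moreover have "u \<noteq> t"
  proof
    assume "u = t"
    then have "[p] \<cdot> t = \<zero>"
      using fixed_by_mult_imp_p_torsion[OF z(1) w t(1)] by (simp add: u_def)
    moreover have "[(2::nat)] \<cdot> t = \<zero>"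
      using t(1) tt by (simp add: numeral_2_eq_2)
    ultimately show False
      using coprime_torsion_eq_zero[of t p 2] t assms(1) by simp
  qed
  moreover have "t \<oplus> u \<noteq> \<zero>"
    using t u \<open>u \<noteq> t\<close> \<open>\<ominus> u = u\<close> minus_equality[of t u] by auto
  moreover have "t \<oplus> u \<noteq> t" "t \<oplus> u \<noteq> u"
    using t u \<open>u \<noteq> \<zero>\<close> by simp_all
  ultimately have "distinct [t \<oplus> u, u, t, \<zero>]"
    using t(3) by simp
  from distinct_card[OF this] have card: "card {t \<oplus> u, u, t, \<zero>} = 4"
    by simp
  \<comment> \<open>The entries of the addition table of the Klein four-group that are needed for
    closure.\<close>
  have tu: "t \<oplus> (t \<oplus> u) = u" "u \<oplus> (t \<oplus> u) = t" "u \<oplus> t = t \<oplus> u"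
    using t u tt uu a_assoc[of t t u] a_lcomm[of u t u] a_comm[of u t] by simp_all
  have "subgroup {t \<oplus> u, u, t, \<zero>} (add_monoid R)"
  proof (rule add.subgroupI)
    fix a assume "a \<in> {t \<oplus> u, u, t, \<zero>}"
    then show "\<ominus> a \<in> {t \<oplus> u, u, t, \<zero>}"
      using t u \<open>\<ominus> u = u\<close> by (auto simp: minus_add)
  next
    fix a b assume "a \<in> {t \<oplus> u, u, t, \<zero>}" "b \<in> {t \<oplus> u, u, t, \<zero>}"
    then show "a \<oplus> b \<in> {t \<oplus> u, u, t, \<zero>}"
      using t(1) u by (elim insertE emptyE) (simp_all add: a_assoc tt uu tu)
  qed (use t u in auto)
  from add.lagrange[OF this] have "4 dvd Coset.order (add_monoid R)"
    unfolding card by (metis dvd_triv_right)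
  then show ?thesis by (simp add: Coset.order_def)
qed

end

lemma (in ring_hom_ring) hom_add_pow_one:
  "h ([(k::nat)] \<cdot>\<^bsub>R\<^esub> \<one>\<^bsub>R\<^esub>) = [k] \<cdot>\<^bsub>S\<^esub> \<one>\<^bsub>S\<^esub>"
proof (induction k)
  case (Suc k)
  then show ?case
    using R.add.nat_pow_Suc[of k "\<one>\<^bsub>R\<^esub>"] S.add.nat_pow_Suc[of k "\<one>\<^bsub>S\<^esub>"] by simp
qed simp

section \<open>The ring Z[\<zeta>] and its finite quotients\<close>

context
  fixes p :: nat and \<zeta> :: complex
  assumes p: "prime p"
  defines "\<zeta> \<equiv> exp (2 * of_real pi * \<i> / of_nat p)"
begin

lemma zeta_power: "\<zeta> ^ p = 1"
  using prime_gt_0_nat[OF p] by (simp add: \<zeta>_def flip: exp_of_nat_mult)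

lemma zeta_neq_1: "\<zeta> \<noteq> 1"
proof
  assume "\<zeta> = 1"
  moreover have "\<zeta> = cis (2 * pi / p)"
    by (simp add: \<zeta>_def cis_conv_exp mult_ac)
  ultimately have "cos (2 * pi / p) = 1"
    by (metis cis.sel(1) one_complex.sel(1))
  \<comment> \<open>The cosine is 1 only at integer multiples of 2 pi, so 1/p would be the integer
    \<open>n\<close>.\<close>
  then obtain n :: int where "2 * pi / p = real_of_int n * 2 * pi"
    using cos_one_2pi_int by blast
  then have "real_of_int (n * int p) = real_of_int 1"
    using prime_gt_0_nat[OF p] by (simp add: field_simps)
  then have "n * int p = 1"
    by (simp only: of_int_eq_iff)
  then have "int p dvd 1" by (metis dvd_triv_right)
  then show False
    using prime_gt_1_nat[OF p] by simp
qed

lemma cyclotomic_ring_simps [simp]: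
  "\<zero>\<^bsub>cyclotomic_ring p\<^esub> = 0" "\<one>\<^bsub>cyclotomic_ring p\<^esub> = 1"
  "x \<oplus>\<^bsub>cyclotomic_ring p\<^esub> y = x + y" "x \<otimes>\<^bsub>cyclotomic_ring p\<^esub> y = x * y"
  by (simp_all add: cyclotomic_ring_def ring_of_type_algebra_def)

lemma cring_cyclotomic_ring: "cring (cyclotomic_ring p)"
proof -
  let ?C = "ring_of_type_algebra :: complex ring"
  interpret C: cring ?C by (rule cring_from_type_algebra)
  have sub: "{\<zeta>} \<subseteq> carrier ?C" by (simp add: ring_of_type_algebra_def)
  have "subcring (generate_ring ?C {\<zeta>}) ?C"
    using C.generate_ring_is_subring[OF sub] by (rule C.subcringI')
  then show ?thesis
    using C.subcring_iff[OF C.generate_ring_incl[OF sub]]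
    by (simp add: cyclotomic_ring_def \<zeta>_def)
qed

lemma zeta_in_cyclotomic_ring: "\<zeta> \<in> carrier (cyclotomic_ring p)"
  by (simp add: cyclotomic_ring_def \<zeta>_def generate_ring.incl)

text \<open>The powers \<zeta>^i with i < p sum to 0, so p is the sum of the differences 1 -
  \<zeta>^i. Each is divisible by 1 - \<zeta> with a geometric sum as quotient, and \<open>w\<close>
  adds up these quotients.\<close>

lemma one_minus_zeta_dvd_p:
  obtains w where "w \<in> carrier (cyclotomic_ring p)" "of_nat p + \<zeta> * w = w"
proof
  interpret R: cring "cyclotomic_ring p" by (rule cring_cyclotomic_ring)
  define w where "w = (\<Sum>i<p. \<Sum>j<i. \<zeta> ^ j)"
  have sum_in: "sum g A \<in> carrier (cyclotomic_ring p)"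
    if "\<And>i. i \<in> A \<Longrightarrow> g i \<in> carrier (cyclotomic_ring p)" for g :: "nat \<Rightarrow> complex" and A
    using that by (induction A rule: infinite_finite_induct)
      (use R.zero_closed R.a_closed in auto)
  have "\<zeta> ^ j \<in> carrier (cyclotomic_ring p)" for j
    using R.m_closed[OF zeta_in_cyclotomic_ring] R.one_closed by (induction j) auto
  then show "w \<in> carrier (cyclotomic_ring p)"
    unfolding w_def by (intro sum_in)
  have "(1 - \<zeta>) * w = (\<Sum>i<p. 1 - \<zeta> ^ i)"
    by (simp add: w_def one_diff_power_eq flip: sum_distrib_left)
  also have "\<dots> = of_nat p - (\<Sum>i<p. \<zeta> ^ i)"
    by (simp add: sum_subtractf)
  also have "(\<Sum>i<p. \<zeta> ^ i) = 0"
    using one_diff_power_eq[of \<zeta> p] zeta_power zeta_neq_1 by simp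
  finally show "of_nat p + \<zeta> * w = w"
    by (simp add: algebra_simps)
qed

text \<open>The interface between ideals and the ring lemmas: \<open>Q\<close> is the quotient by
  the ideal, and \<open>z\<close> and \<open>w\<close> are the classes of \<zeta> and of the
  cofactor of 1 - \<zeta> in p.\<close>

lemma norm_setE:
  assumes "m \<in> norm_set p"
  obtains Q :: "complex set ring" and z w where
    "cring Q" "finite (carrier Q)" "m = card (carrier Q)" "z \<in> carrier Q" "z [^]\<^bsub>Q\<^esub> p = \<one>\<^bsub>Q\<^esub>"
    "w \<in> carrier Q" "[p] \<cdot>\<^bsub>Q\<^esub> \<one>\<^bsub>Q\<^esub> \<oplus>\<^bsub>Q\<^esub> z \<otimes>\<^bsub>Q\<^esub> w = w"
proof -
  interpret R: cring "cyclotomic_ring p" by (rule cring_cyclotomic_ring)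
  from assms obtain I where I: "ideal I (cyclotomic_ring p)"
    and m: "m > 0" "m = card (carrier (cyclotomic_ring p Quot I))"
    by (auto simp: norm_set_def ideal_norm_def)
  interpret I: ideal I "cyclotomic_ring p" by (rule I)
  let ?Q = "cyclotomic_ring p Quot I" and ?h = "(+>\<^bsub>cyclotomic_ring p\<^esub>) I"
  interpret h: ring_hom_ring "cyclotomic_ring p" ?Q ?h by (rule I.rcos_ring_hom_ring)
  obtain w where w: "w \<in> carrier (cyclotomic_ring p)" "of_nat p + \<zeta> * w = w"
    by (rule one_minus_zeta_dvd_p)
  have pow: "\<zeta> [^]\<^bsub>cyclotomic_ring p\<^esub> n = \<zeta> ^ n" for n :: nat
    by (induction n) auto
  have of_nat: "[k] \<cdot>\<^bsub>cyclotomic_ring p\<^esub> 1 = of_nat k" for k :: nat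
    by (induction k) (use R.add.nat_pow_Suc in auto)
  show thesis
  proof
    show "cring ?Q" by (rule I.quotient_is_cring[OF R.is_cring])
    \<comment> \<open>An infinite quotient would have \<open>card\<close> 0, but norms in
      \<open>norm_set\<close> are positive.\<close>
    show "finite (carrier ?Q)" using m card_ge_0_finite by blast
    show "m = card (carrier ?Q)" by (rule m)
    show "?h \<zeta> \<in> carrier ?Q" "?h w \<in> carrier ?Q"
      using w zeta_in_cyclotomic_ring by (auto intro: h.hom_closed)
    show "?h \<zeta> [^]\<^bsub>?Q\<^esub> p = \<one>\<^bsub>?Q\<^esub>"
      using h.hom_nat_pow[OF zeta_in_cyclotomic_ring, of p] h.hom_one zeta_power
      by (simp add: pow)
    \<comment> \<open>The relation p + \<zeta> w = w is stated in ring operations, so that the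
      quotient map carries it over term by term.\<close>
    have "?h (([p] \<cdot>\<^bsub>cyclotomic_ring p\<^esub> \<one>\<^bsub>cyclotomic_ring p\<^esub>)
            \<oplus>\<^bsub>cyclotomic_ring p\<^esub> \<zeta> \<otimes>\<^bsub>cyclotomic_ring p\<^esub> w) = ?h w"
      using w by (simp add: of_nat)
    then show "[p] \<cdot>\<^bsub>?Q\<^esub> \<one>\<^bsub>?Q\<^esub> \<oplus>\<^bsub>?Q\<^esub> ?h \<zeta> \<otimes>\<^bsub>?Q\<^esub> ?h w = ?h w"
      using w(1) zeta_in_cyclotomic_ring h.hom_add_pow_one[of p]
        h.hom_add[of "[p] \<cdot>\<^bsub>cyclotomic_ring p\<^esub> \<one>\<^bsub>cyclotomic_ring p\<^esub>" "\<zeta> \<otimes>\<^bsub>cyclotomic_ring p\<^esub> w"]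
        h.hom_mult[of \<zeta> w] R.add.nat_pow_closed[OF R.one_closed, of p] R.m_closed
      by metis
  qed
qed

end

section \<open>Congruence conditions on norms, and the exceptional integers\<close>

lemma norm_cong_one:
  assumes "prime p" "m \<in> norm_set p" "\<not> p dvd m"
  shows "[m = 1] (mod p)"
proof -
  obtain Q :: "complex set ring" and z w where
    "cring Q" "finite (carrier Q)" "m = card (carrier Q)" "z \<in> carrier Q" "z [^]\<^bsub>Q\<^esub> p = \<one>\<^bsub>Q\<^esub>"
    "w \<in> carrier Q" "[p] \<cdot>\<^bsub>Q\<^esub> \<one>\<^bsub>Q\<^esub> \<oplus>\<^bsub>Q\<^esub> z \<otimes>\<^bsub>Q\<^esub> w = w"
    using assms(2) by (rule norm_setE[OF assms(1)])
  then show ?thesis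
    using cring.card_cong_one_mod_prime[of Q p z w] assms by blast
qed

lemma even_norm_dvd_4:
  assumes "prime p" "odd p" "m \<in> norm_set p" "even m"
  shows "4 dvd m"
proof -
  obtain Q :: "complex set ring" and z w where
    "cring Q" "finite (carrier Q)" "m = card (carrier Q)" "z \<in> carrier Q" "z [^]\<^bsub>Q\<^esub> p = \<one>\<^bsub>Q\<^esub>"
    "w \<in> carrier Q" "[p] \<cdot>\<^bsub>Q\<^esub> \<one>\<^bsub>Q\<^esub> \<oplus>\<^bsub>Q\<^esub> z \<otimes>\<^bsub>Q\<^esub> w = w"
    using assms(3) by (rule norm_setE[OF assms(1)])
  then show ?thesis
    using cring.four_dvd_card_if_even[of Q p z w] assms by blast
qed

theorem mainTheorem1:
  fixes p :: nat
  assumes "prime p" and "p \<ge> 3"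
  shows "infinite {n::nat. n > 0 \<and>
           \<not> (\<exists>m\<in>norm_set p. \<exists>j\<le>p - 2. \<exists>b :: nat \<Rightarrow> nat.
                 n = m + (\<Sum>i=1..j. p ^ b i))}"
    (is "infinite ?S")
proof -
  have "odd p" using assms prime_odd_nat by auto
  \<comment> \<open>Since \<open>p\<close> is odd, its square is 1 modulo 4, so \<open>N k\<close>
    is 2 modulo 4; it is also 1 modulo \<open>p\<close>. The term \<open>4 * p * k\<close> changes
    neither residue and provides infinitely many values.\<close>
  define N where "N k = 1 + p ^ 2 + 4 * p * k" for k
  have N_mod_4: "even (N k)" "\<not> 4 dvd N k" for k
  proof -
    obtain c where c: "p = 2 * c + 1" using \<open>odd p\<close> by (rule oddE)
    have "N k = 2 + 4 * (c * c + c + p * k)"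
      by (simp add: N_def power2_eq_square c algebra_simps)
    then show "even (N k)" "\<not> 4 dvd N k" by presburger+
  qed
  have N_mod_p: "[N k = 1] (mod p)" for k
  proof -
    have "N k = 1 + p * (p + 4 * k)"
      by (simp add: N_def power2_eq_square algebra_simps)
    then show ?thesis by (simp only: cong_def mod_mult_self2)
  qed
  have "N k + (p - 2) \<in> ?S" for k
  proof -
    have False
      if m: "m \<in> norm_set p" and j: "j \<le> p - 2"
        and eq: "N k + (p - 2) = m + (\<Sum>i=1..j. p ^ b i)" for m j and b :: "nat \<Rightarrow> nat"
    proof -
      \<comment> \<open>\<open>c\<close> counts the summands equal to 1; every other power of
        \<open>p\<close> vanishes modulo \<open>p\<close>.\<close>
      define c where "c = card {i \<in> {1..j}. b i = 0}"
      have "c \<le> card {1..j}" unfolding c_def by (intro card_mono) auto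
      then have c_le: "c \<le> j" by simp
      \<comment> \<open>These bounds turn the congruences modulo \<open>p\<close> of
        \<open>p - 1\<close> with \<open>c\<close> and with \<open>1 + c\<close> into
        equalities.\<close>
      have lt: "p - 1 < p" "1 + c < p" using c_le j assms(2) by linarith+
      have "[(\<Sum>i=1..j. p ^ b i) = (\<Sum>i=1..j. if b i = 0 then 1 else 0)] (mod p)"
        by (intro cong_sum) (auto simp: cong_0_iff)
      also have "(\<Sum>i=1..j. if b i = 0 then 1 else 0) = c"
        by (simp add: c_def sum.If_cases Int_def)
      finally have "[m + (\<Sum>i=1..j. p ^ b i) = m + c] (mod p)"
        by (intro cong_add cong_refl)
      moreover have "[N k + (p - 2) = 1 + (p - 2)] (mod p)"
        using N_mod_p by (intro cong_add cong_refl)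
      ultimately have *: "[p - 1 = m + c] (mod p)"
        using eq assms(2) by (simp add: cong_def)
      \<comment> \<open>A norm divisible by \<open>p\<close> would leave only \<open>c\<close> to
        supply the residue \<open>p - 1\<close>, but \<open>c\<close> is at most
        \<open>p - 2\<close>.\<close>
      have "\<not> p dvd m"
      proof
        assume "p dvd m"
        then have "[m + c = 0 + c] (mod p)"
          by (intro cong_add cong_refl) (simp add: cong_0_iff)
        with * have "[p - 1 = c] (mod p)"
          by (auto intro: cong_trans)
        then have "p - 1 = c"
          using cong_less_modulus_unique_nat[OF _ lt(1)] lt(2) by simp
        then show False using lt by simp
      qed
      then have "[m + c = 1 + c] (mod p)"
        using norm_cong_one[OF assms(1) m] by (intro cong_add cong_refl)
      with * have "[p - 1 = 1 + c] (mod p)"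
        by (rule cong_trans)
      then have "p - 1 = 1 + c"
        using cong_less_modulus_unique_nat lt by blast
      \<comment> \<open>All \<open>p - 2\<close> permitted powers are used and all their exponents
        are 0, so the sum of powers cancels and \<open>m = N k\<close>, an even number not divisible
        by 4.\<close>
      then have c: "c = p - 2" "j = p - 2" using c_le j by simp_all
      have "{i \<in> {1..j}. b i = 0} = {1..j}"
        by (rule card_subset_eq) (use c in \<open>auto simp: c_def\<close>)
      then have "b i = 0" if "i \<in> {1..j}" for i
        using that by blast
      then have "(\<Sum>i=1..j. p ^ b i) = (\<Sum>i=1..j. 1)"
        by (intro sum.cong refl) (simp only: power_0)
      then have "m = N k" using eq c by simp
      then show False
        using even_norm_dvd_4[OF assms(1) \<open>odd p\<close> m] N_mod_4 by simp
    qed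
    then show ?thesis by (auto simp: N_def)
  qed
  then have "range (\<lambda>k. N k + (p - 2)) \<subseteq> ?S"
    by (intro image_subsetI)
  moreover have "inj (\<lambda>k. N k + (p - 2))"
  proof (rule injI)
    fix k l assume "N k + (p - 2) = N l + (p - 2)"
    then have "4 * p * k = 4 * p * l" by (simp only: N_def add_left_cancel add_right_cancel)
    then show "k = l" using assms(2) by simp
  qed
  ultimately show ?thesis
    by (rule infinite_super[OF _ range_inj_infinite])
qed

end
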